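(* Let $H$ be a complex Hilbert space and $\{\mathcal{U}(t)\}_{t\geq 0}$ a strongly continuous semigroup on $H$ with generator $\mathcal{L}$. Let $z\in D(\mathcal{L})\cap D(\mathcal{L}^\dagger)$ with $z\neq0$, $\mathcal{P}:=(\cdot,z)(z,z)^{-1}z$, $\mathcal{Q}:=1-\mathcal{P}$. For $K:\mathbb{R}_+\to\mathbb{C}$ and $\eta:\mathbb{R}_+\to H$ consider the system $$\frac{d}{dt}\mathcal{U}(t)z=\mathcal{U}(t)\mathcal{PL}z+\eta_t+\int_0^tK(t-s)\,\mathcal{U}(s)z\,ds,\qquad K(t)=(\eta_t,\mathcal{Q}\mathcal{L}^\dagger z)(z,z)^{-1},$$ for all $t\ge0$. This system has a unique solution $(K,\eta)$. The memory kernel $K$ is the unique continuous solution of the Volterra equation $$K(t)=(\mathcal{U}(t)\mathcal{QL}z,\mathcal{Q}\mathcal{L}^\dagger z)(z,z)^{-1}-\int_0^tK(t-s)\,(\mathcal{U}(s)z,\mathcal{Q}\mathcal{L}^\dagger z)(z,z)^{-1}\,ds,$$ and $\eta_t=\mathcal{U}(t)\mathcal{QL}z-\int_0^tK(t-s)\,\mathcal{U}(s)z\,ds$.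
   Context: The scalar product $(\cdot,\cdot)$ on $H$ is conjugate-linear in its second argument. The generator is $\mathcal{L}x:=\lim_{h\searrow 0}\frac1h[\mathcal{U}(h)x-x]$ on the set $D(\mathcal{L})$ where the limit exists; $\dagger$ denotes the adjoint. Vector-valued integrals are Bochner integrals. *)

theory Defs
  imports "HOL-Analysis.Analysis"
begin

text \<open>Complex Hilbert space: a real Banach space with a complex scalar multiplication
  and a complex inner product, conjugate-linear in its second argument, inducing the norm.\<close>

class complex_hilbert = banach +
  fixes cscale :: "complex \<Rightarrow> 'a \<Rightarrow> 'a" (infixr \<open>*\<^sub>C\<close> 75)
    and cinner :: "'a \<Rightarrow> 'a \<Rightarrow> complex"
  assumes cscale_add_right: "a *\<^sub>C (x + y) = a *\<^sub>C x + a *\<^sub>C y"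
    and cscale_add_left: "(a + b) *\<^sub>C x = a *\<^sub>C x + b *\<^sub>C x"
    and cscale_cscale: "a *\<^sub>C (b *\<^sub>C x) = (a * b) *\<^sub>C x"
    and cscale_one: "1 *\<^sub>C x = x"
    and scaleR_cscale: "r *\<^sub>R x = complex_of_real r *\<^sub>C x"
    and cinner_add_left: "cinner (x + y) w = cinner x w + cinner y w"
    and cinner_cscale_left: "cinner (a *\<^sub>C x) y = a * cinner x y"
    and cinner_commute: "cinner y x = cnj (cinner x y)"
    and cinner_self_norm: "cinner x x = complex_of_real ((norm x)\<^sup>2)"

definition C0_semigroup :: "(real \<Rightarrow> 'a::complex_hilbert \<Rightarrow> 'a) \<Rightarrow> bool" where
  "C0_semigroup U \<longleftrightarrow>
     (\<forall>t\<ge>0. bounded_linear (U t) \<and> (\<forall>c x. U t (c *\<^sub>C x) = c *\<^sub>C U t x)) \<and>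
     U 0 = id \<and>
     (\<forall>s\<ge>0. \<forall>t\<ge>0. U (s + t) = U s \<circ> U t) \<and>
     (\<forall>x. continuous_on {0..} (\<lambda>t. U t x))"

definition gen_dom :: "(real \<Rightarrow> 'a::complex_hilbert \<Rightarrow> 'a) \<Rightarrow> 'a set" where
  "gen_dom U = {x. \<exists>y. ((\<lambda>h. (1 / h) *\<^sub>R (U h x - x)) \<longlongrightarrow> y) (at_right 0)}"

definition gen :: "(real \<Rightarrow> 'a::complex_hilbert \<Rightarrow> 'a) \<Rightarrow> 'a \<Rightarrow> 'a" where
  "gen U x = Lim (at_right 0) (\<lambda>h. (1 / h) *\<^sub>R (U h x - x))"

definition adj_dom :: "'a::complex_hilbert set \<Rightarrow> ('a \<Rightarrow> 'a) \<Rightarrow> 'a set" where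
  "adj_dom D A = {y. \<exists>w. \<forall>x\<in>D. cinner (A x) y = cinner x w}"

definition adj :: "'a::complex_hilbert set \<Rightarrow> ('a \<Rightarrow> 'a) \<Rightarrow> 'a \<Rightarrow> 'a" where
  "adj D A y = (THE w. \<forall>x\<in>D. cinner (A x) y = cinner x w)"

definition projP :: "'a::complex_hilbert \<Rightarrow> 'a \<Rightarrow> 'a" where
  "projP z x = (cinner x z / cinner z z) *\<^sub>C z"

definition projQ :: "'a::complex_hilbert \<Rightarrow> 'a \<Rightarrow> 'a" where
  "projQ z x = x - projP z x"

definition gle_system ::
  "(real \<Rightarrow> 'a::complex_hilbert \<Rightarrow> 'a) \<Rightarrow> 'a \<Rightarrow> (real \<Rightarrow> complex) \<Rightarrow> (real \<Rightarrow> 'a) \<Rightarrow> bool" where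
  "gle_system U z K \<eta> \<longleftrightarrow>
     (\<forall>t\<ge>0. K absolutely_integrable_on {0..t}) \<and>
     (\<forall>t\<ge>0.
        ((\<lambda>s. U s z) has_vector_derivative
           (U t (projP z (gen U z)) + \<eta> t + integral {0..t} (\<lambda>s. K (t - s) *\<^sub>C U s z)))
          (at t within {0..}) \<and>
        K t = cinner (\<eta> t) (projQ z (adj (gen_dom U) (gen U) z)) / cinner z z)"

definition volterra_eq :: "(real \<Rightarrow> 'a::complex_hilbert \<Rightarrow> 'a) \<Rightarrow> 'a \<Rightarrow> (real \<Rightarrow> complex) \<Rightarrow> real \<Rightarrow> bool" where
  "volterra_eq U z K t \<longleftrightarrow>
     K t = cinner (U t (projQ z (gen U z))) (projQ z (adj (gen_dom U) (gen U) z)) / cinner z z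
           - integral {0..t} (\<lambda>s. K (t - s) *
               (cinner (U s z) (projQ z (adj (gen_dom U) (gen U) z)) / cinner z z))"

end

theory Submission
  imports Defs
begin

text \<open>
  Since \<open>U(t)z\<close> has derivative \<open>U(t)Lz = U(t)PLz + U(t)QLz\<close>, the first equation of the
  system forces \<open>\<eta>\<^sub>t = U(t)QLz - \<integral>\<^sub>0\<^sup>t K(t-s) U(s)z ds\<close>. Pairing this with
  \<open>QL\<^sup>\<dagger>z\<close> turns the second equation into the Volterra equation \<open>K = g - k * K\<close> with the
  continuous correlation functions \<open>g(t) = (U(t)QLz, QL\<^sup>\<dagger>z)/(z,z)\<close> and
  \<open>k(s) = (U(s)z, QL\<^sup>\<dagger>z)/(z,z)\<close>; so the system is equivalent to the Volterra equation
  together with the formula for \<open>\<eta>\<close>. A Volterra equation of the second kind with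
  continuous kernel has exactly one locally integrable solution, and it is continuous: the
  increments of the Picard iterates are bounded by \<open>C (M t)\<^sup>n / n!\<close>, so the iterates converge
  locally uniformly, and the same factorial bound forces the difference of two solutions to vanish.
\<close>

section \<open>Complex Hilbert spaces\<close>

lemma linear_cinner_left: "linear (\<lambda>x. cinner x y)"
  by (rule linearI) (simp_all add: cinner_add_left scaleR_cscale cinner_cscale_left scaleR_conv_of_real)

lemma cinner_add_right: "cinner x (y + w) = cinner x y + cinner x w"
  by (metis cinner_commute cinner_add_left complex_cnj_add)

lemma cinner_cscale_right: "cinner x (a *\<^sub>C y) = cnj a * cinner x y"
  by (metis cinner_commute cinner_cscale_left complex_cnj_mult)

lemma norm_cscale: "norm (a *\<^sub>C x) = cmod a * norm x"
proof -
  have "cinner (a *\<^sub>C x) (a *\<^sub>C x) = complex_of_real ((cmod a)\<^sup>2) * cinner x x"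
    by (simp only: cinner_cscale_left cinner_cscale_right complex_norm_square mult_ac)
  then have "complex_of_real ((norm (a *\<^sub>C x))\<^sup>2) = complex_of_real ((cmod a * norm x)\<^sup>2)"
    by (simp only: cinner_self_norm power_mult_distrib of_real_mult)
  then have "(norm (a *\<^sub>C x))\<^sup>2 = (cmod a * norm x)\<^sup>2"
    by (simp only: of_real_eq_iff)
  then show ?thesis
    by (simp add: power2_eq_iff_nonneg)
qed

lemma bounded_bilinear_cscale: "bounded_bilinear cscale"
proof
  show "(r *\<^sub>R a) *\<^sub>C x = r *\<^sub>R (a *\<^sub>C x)" "a *\<^sub>C (r *\<^sub>R x) = r *\<^sub>R (a *\<^sub>C x)" for r a and x :: 'a
    by (simp_all add: scaleR_cscale cscale_cscale scaleR_conv_of_real mult.commute)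
  show "\<exists>K. \<forall>a x. norm (a *\<^sub>C (x::'a)) \<le> norm a * norm x * K"
    by (auto simp: norm_cscale intro!: exI[of _ 1])
qed (simp_all add: cscale_add_left cscale_add_right)

lemma power2_norm_add_cinner: "(norm (x + y))\<^sup>2 = (norm x)\<^sup>2 + (norm y)\<^sup>2 + 2 * Re (cinner x y)"
proof -
  have "cinner (x + y) (x + y) = cinner x x + cinner y y + (cinner x y + cnj (cinner x y))"
    by (simp add: cinner_add_left cinner_add_right cinner_commute[of y x])
  then have "complex_of_real ((norm (x + y))\<^sup>2)
      = complex_of_real ((norm x)\<^sup>2 + (norm y)\<^sup>2 + 2 * Re (cinner x y))"
    by (simp only: cinner_self_norm complex_add_cnj of_real_add)
  then show ?thesis
    by (simp only: of_real_eq_iff)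
qed

lemma abs_Re_cinner_le: "\<bar>Re (cinner x y)\<bar> \<le> norm x * norm y"
proof -
  have "Re (cinner x (- y)) = - Re (cinner x y)"
    using linear_neg[OF linear_cinner_left, of y x] by (simp add: cinner_commute[of x])
  then have "(norm (x - y))\<^sup>2 = (norm x)\<^sup>2 + (norm y)\<^sup>2 - 2 * Re (cinner x y)"
    using power2_norm_add_cinner[of x "- y"] by simp
  moreover have "(norm (x - y))\<^sup>2 \<le> (norm x + norm y)\<^sup>2" "(norm (x + y))\<^sup>2 \<le> (norm x + norm y)\<^sup>2"
    by (simp_all add: power_mono norm_triangle_ineq4 norm_triangle_ineq)
  ultimately show ?thesis
    using power2_norm_add_cinner[of x y] by (simp add: power2_sum abs_le_iff)
qed

text \<open>The constant 2 (instead of Cauchy--Schwarz's 1) suffices for boundedness.\<close>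
lemma norm_cinner_le: "cmod (cinner x y) \<le> 2 * (norm x * norm y)"
proof -
  have "\<bar>Im (cinner x y)\<bar> \<le> norm x * norm y"
    using abs_Re_cinner_le[of "(-\<i>) *\<^sub>C x" y] by (simp add: cinner_cscale_left norm_cscale)
  then show ?thesis
    using abs_Re_cinner_le[of x y] cmod_le[of "cinner x y"] by linarith
qed

lemma bounded_linear_cinner_left: "bounded_linear (\<lambda>x. cinner x y)"
proof (rule bounded_linear_intro[where K = "2 * norm y"])
  show "norm (cinner x y) \<le> norm x * (2 * norm y)" for x
    using norm_cinner_le[of x y] by (simp add: mult_ac)
qed (simp_all add: linear_add[OF linear_cinner_left] linear_scale[OF linear_cinner_left])

section \<open>Right derivatives on the half-line\<close>

lemma at_within_Icc_eq_atLeast: "x < b \<Longrightarrow> at x within {a..b} = at x within {a..}"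
  for x :: real
  by (rule at_within_nhd[of _ "{..<b}"]) auto

lemma at_within_atLeast_nontrivial: "a \<le> x \<Longrightarrow> at x within {a..} \<noteq> bot"
  for x :: real
proof
  assume "a \<le> x" "at x within {a..} = bot"
  moreover have "at_right x \<le> at x within {a..}"
    using \<open>a \<le> x\<close> by (intro at_le) auto
  ultimately show False
    by (simp add: bot_unique)
qed

lemma continuous_on_atLeast_if_Icc:
  fixes f :: "real \<Rightarrow> 'b::topological_space"
  assumes "\<And>b. continuous_on {a..b} f"
  shows "continuous_on {a..} f"
  unfolding continuous_on_eq_continuous_within
proof
  fix x assume "x \<in> {a..}"
  then have "continuous (at x within {a..x+1}) f"
    using assms[of "x + 1"] by (simp add: continuous_on_eq_continuous_within)
  then show "continuous (at x within {a..}) f"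
    by (simp add: at_within_Icc_eq_atLeast)
qed

lemma has_vector_derivative_imp_right_quotient:
  fixes f :: "real \<Rightarrow> 'b::real_normed_vector"
  assumes "(f has_vector_derivative f') (at t within {t..})"
  shows "((\<lambda>h. (1/h) *\<^sub>R (f (t+h) - f t)) \<longlongrightarrow> f') (at_right 0)"
proof -
  have "((\<lambda>y. (1 / norm(y - t)) *\<^sub>R (f y - (f t + (y - t) *\<^sub>R f'))) \<longlongrightarrow> 0) (at_right t)"
    using assms unfolding has_vector_derivative_def has_derivative_within at_within_Ici_at_right
    by blast
  then have "((\<lambda>h. (1 / norm h) *\<^sub>R (f (t+h) - (f t + h *\<^sub>R f'))) \<longlongrightarrow> 0) (at_right 0)"
    by (simp add: at_right_to_0[of t] filterlim_filtermap add.commute)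
  then have "((\<lambda>h. (1/h) *\<^sub>R (f (t+h) - f t) - f') \<longlongrightarrow> 0) (at_right 0)"
    by (rule Lim_transform_eventually)
      (auto simp: eventually_at_right_field algebra_simps intro!: exI[of _ 1])
  then show ?thesis
    by (rule Lim_null[THEN iffD2])
qed

text \<open>A sup argument: the last time up to \<open>T\<close> where \<open>norm (g t - g 0) \<le> e * t\<close> holds can
  only be \<open>T\<close> itself, since a vanishing right derivative lets the inequality propagate.\<close>
lemma right_derivative_zero_imp_norm_le:
  fixes g :: "real \<Rightarrow> 'b::real_normed_vector"
  assumes cont: "continuous_on {0..} g"
    and rd: "\<And>t. t \<ge> 0 \<Longrightarrow> ((\<lambda>h. (1/h) *\<^sub>R (g (t+h) - g t)) \<longlongrightarrow> 0) (at_right 0)"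
    and T: "T \<ge> 0" and e: "e > 0"
  shows "norm (g T - g 0) \<le> e * T"
proof (rule ccontr)
  assume neg: "\<not> norm (g T - g 0) \<le> e * T"
  define S where "S = {0..T} \<inter> (\<lambda>t. norm (g t - g 0) - e * t) -` {..0}"
  have "closed S"
    unfolding S_def
    by (intro continuous_closed_preimage continuous_intros continuous_on_subset[OF cont]) auto
  moreover have "0 \<in> S" "bdd_above S"
    using T by (auto simp: S_def intro: bdd_aboveI[of _ T])
  ultimately have "Sup S \<in> S"
    using closed_contains_Sup by blast
  define s where "s = Sup S"
  have s: "0 \<le> s" "s < T" "norm (g s - g 0) \<le> e * s"
    using \<open>Sup S \<in> S\<close> neg by (auto simp: S_def s_def order.order_iff_strict)
  obtain b where "b > 0"
    and b: "\<And>h. 0 < h \<Longrightarrow> h < b \<Longrightarrow> norm ((1/h) *\<^sub>R (g (s+h) - g s)) < e"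
    using tendstoD[OF rd[OF s(1)] e] by (auto simp: eventually_at_right_field dist_norm)
  define h where "h = min b (T - s) / 2"
  have h: "0 < h" "h < b" "s + h \<le> T"
    using \<open>b > 0\<close> s(2) by (auto simp: h_def min_def field_simps)
  have "norm (g (s+h) - g s) / h < e"
    using b[OF h(1,2)] by (simp only: norm_scaleR abs_divide abs_one abs_of_pos[OF h(1)]) simp
  then have "norm (g (s+h) - g s) < e * h"
    using h(1) by (simp add: field_simps)
  then have "norm (g (s+h) - g 0) \<le> e * (s + h)"
    using s(3) norm_triangle_ineq[of "g (s+h) - g s" "g s - g 0"] by (simp add: distrib_left)
  then have "s + h \<in> S"
    using h s by (simp add: S_def)
  then have "s + h \<le> s"
    unfolding s_def by (rule cSup_upper[OF _ \<open>bdd_above S\<close>])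
  then show False
    using h(1) by simp
qed

lemma right_derivative_zero_imp_const:
  fixes g :: "real \<Rightarrow> 'b::real_normed_vector"
  assumes "continuous_on {0..} g"
    and "\<And>t. t \<ge> 0 \<Longrightarrow> ((\<lambda>h. (1/h) *\<^sub>R (g (t+h) - g t)) \<longlongrightarrow> 0) (at_right 0)"
    and "T \<ge> 0"
  shows "g T = g 0"
proof -
  have "norm (g T - g 0) \<le> 0 + e" if "e > 0" for e
  proof -
    have "norm (g T - g 0) \<le> e / (T + 1) * T"
      using right_derivative_zero_imp_norm_le[OF assms, of "e / (T + 1)"] that \<open>T \<ge> 0\<close> by simp
    also have "\<dots> \<le> e"
      using that \<open>T \<ge> 0\<close> by (simp add: field_simps)
    finally show ?thesis by simp
  qed
  then have "norm (g T - g 0) \<le> 0"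
    by (rule field_le_epsilon)
  then show ?thesis
    by simp
qed

section \<open>Integrability of bilinear products\<close>

lemma has_integral_reflect_interval:
  fixes f :: "real \<Rightarrow> 'b::real_normed_vector"
  shows "((\<lambda>s. f (t - s)) has_integral i) {0..t} \<longleftrightarrow> (f has_integral i) {0..t}"
  using has_integral_reflect_real[where f = "\<lambda>x. f (x + t)" and a = "-t" and b = 0]
    has_integral_shift_real_ivl_iff[of f i 0 t t] by simp

lemma integrable_reflect_interval:
  fixes f :: "real \<Rightarrow> 'b::real_normed_vector"
  shows "(\<lambda>s. f (t - s)) integrable_on {0..t} \<longleftrightarrow> f integrable_on {0..t}"
  by (simp add: integrable_on_def has_integral_reflect_interval)

lemma integral_reflect_interval:
  fixes f :: "real \<Rightarrow> 'b::real_normed_vector"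
  shows "integral {0..t} (\<lambda>s. f (t - s)) = integral {0..t} f"
  by (simp add: integral_def has_integral_reflect_interval integrable_reflect_interval)

lemma absolutely_integrable_reflect_interval:
  fixes f :: "real \<Rightarrow> 'b::euclidean_space"
  shows "(\<lambda>s. f (t - s)) absolutely_integrable_on {0..t} \<longleftrightarrow> f absolutely_integrable_on {0..t}"
  using integrable_reflect_interval[of f t] integrable_reflect_interval[of "\<lambda>x. norm (f x)" t]
  by (simp add: absolutely_integrable_on_def)

lemma absolutely_integrable_on_Icc0:
  fixes f :: "real \<Rightarrow> 'b::euclidean_space"
  assumes "continuous_on {0..} f"
  shows "f absolutely_integrable_on {0..t}"
  by (intro absolutely_integrable_continuous_real continuous_on_subset[OF assms]) auto

lemma operative_approximable_weighted:
  fixes f :: "'b::euclidean_space \<Rightarrow> 'a::banach"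
  assumes "0 \<le> e" and w: "\<And>x. 0 \<le> w x"
  shows "operative conj True (\<lambda>i. \<exists>g. (\<forall>x\<in>i. norm (f x - g (x::'b)) \<le> e * w x) \<and> g integrable_on i)"
proof -
  interpret comm_monoid conj True
    by standard auto
  show ?thesis
  proof (standard, safe)
    fix a b :: 'b
    show "\<exists>g. (\<forall>x\<in>cbox a b. norm (f x - g x) \<le> e * w x) \<and> g integrable_on cbox a b"
      if "box a b = {}" for a b
      using assms that
      by (metis content_eq_0_interior integrable_on_null interior_cbox norm_zero right_minus_eq zero_le_mult_iff)
    show "\<exists>g. (\<forall>x\<in>cbox a b \<inter> {x. x \<bullet> k \<le> c}. norm (f x - g x) \<le> e * w x)
          \<and> g integrable_on cbox a b \<inter> {x. x \<bullet> k \<le> c}"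
        "\<exists>g. (\<forall>x\<in>cbox a b \<inter> {x. c \<le> x \<bullet> k}. norm (f x - g x) \<le> e * w x)
          \<and> g integrable_on cbox a b \<inter> {x. c \<le> x \<bullet> k}"
      if "\<forall>x\<in>cbox a b. norm (f x - g x) \<le> e * w x" and "g integrable_on cbox a b" and "k \<in> Basis"
      for c g and k :: 'b
      using that by auto
    show "\<exists>g. (\<forall>x\<in>cbox a b. norm (f x - g x) \<le> e * w x) \<and> g integrable_on cbox a b"
      if fg1: "\<forall>x\<in>cbox a b \<inter> {x. x \<bullet> k \<le> c}. norm (f x - g1 x) \<le> e * w x"
        and g1: "g1 integrable_on cbox a b \<inter> {x. x \<bullet> k \<le> c}"
        and fg2: "\<forall>x\<in>cbox a b \<inter> {x. c \<le> x \<bullet> k}. norm (f x - g2 x) \<le> e * w x"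
        and g2: "g2 integrable_on cbox a b \<inter> {x. c \<le> x \<bullet> k}"
        and k: "k \<in> Basis"
      for c k g1 g2
    proof (intro exI conjI ballI)
      let ?g = "\<lambda>x. if x \<bullet> k = c then f x else if x \<bullet> k \<le> c then g1 x else g2 x"
      show "norm (f x - ?g x) \<le> e * w x" if "x \<in> cbox a b" for x
        using that assms fg1 fg2 by auto
      have "?g integrable_on cbox a b \<inter> {x. x \<bullet> k \<le> c}" "?g integrable_on cbox a b \<inter> {x. x \<bullet> k \<ge> c}"
        by (rule integrable_spike[OF _ negligible_standard_hyperplane[of k c]], use k g1 g2 in auto)+
      with has_integral_split[OF _ _ k] show "?g integrable_on cbox a b"
        unfolding integrable_on_def by blast
    qed
  qed
qed

lemma approximable_weighted_on_division:
  fixes f :: "'b::euclidean_space \<Rightarrow> 'a::banach"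
  assumes "0 \<le> e" and "\<And>x. 0 \<le> w x"
    and "d division_of (cbox a b)"
    and "\<forall>i\<in>d. \<exists>g. (\<forall>x\<in>i. norm (f x - g x) \<le> e * w x) \<and> g integrable_on i"
  shows "\<exists>g. (\<forall>x\<in>cbox a b. norm (f x - g x) \<le> e * w x) \<and> g integrable_on cbox a b"
proof -
  interpret operative conj True "\<lambda>i. \<exists>g. (\<forall>x\<in>i. norm (f x - g (x::'b)) \<le> e * w x) \<and> g integrable_on i"
    using assms(1,2) by (rule operative_approximable_weighted)
  show ?thesis
    using division[OF assms(3)] assms(4) by auto
qed

abbreviation tagged_sum :: "('b::euclidean_space \<Rightarrow> 'c::real_normed_vector) \<Rightarrow> ('b \<times> 'b set) set \<Rightarrow> 'c"
  where "tagged_sum f D \<equiv> \<Sum>(x,K)\<in>D. Henstock_Kurzweil_Integration.content K *\<^sub>R f x"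

lemma norm_tagged_sum_diff_le:
  assumes "p tagged_division_of S" and "\<And>x. x \<in> S \<Longrightarrow> norm (F x - G x) \<le> e * w x"
  shows "norm (tagged_sum F p - tagged_sum G p) \<le> e * tagged_sum w p"
proof -
  have "norm (tagged_sum F p - tagged_sum G p)
      \<le> (\<Sum>(x,K)\<in>p. norm (Henstock_Kurzweil_Integration.content K *\<^sub>R (F x - G x)))"
    by (simp add: case_prod_unfold scaleR_diff_right norm_sum flip: sum_subtractf)
  also have "\<dots> \<le> (\<Sum>(x,K)\<in>p. e * (Henstock_Kurzweil_Integration.content K *\<^sub>R w x))"
  proof (rule sum_mono, clarify)
    fix x K assume "(x, K) \<in> p"
    then have "x \<in> S"
      using assms(1) by blast
    then show "norm (Henstock_Kurzweil_Integration.content K *\<^sub>R (F x - G x))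
        \<le> e * (Henstock_Kurzweil_Integration.content K *\<^sub>R w x)"
      using mult_left_mono[OF assms(2) content_pos_le] by (simp add: mult_ac)
  qed
  finally show ?thesis
    by (simp add: sum_distrib_left case_prod_unfold)
qed

lemma integrable_weighted_limit:
  fixes F :: "'b::euclidean_space \<Rightarrow> 'c::banach"
  assumes w: "w integrable_on cbox a b"
    and approx: "\<And>e. e > 0 \<Longrightarrow> \<exists>G. (\<forall>x\<in>cbox a b. norm (F x - G x) \<le> e * w x) \<and> G integrable_on cbox a b"
  shows "F integrable_on cbox a b"
  unfolding integrable_Cauchy
proof (intro allI impI)
  fix \<epsilon> :: real assume "\<epsilon> > 0"
  define I where "I = integral (cbox a b) w"
  define e where "e = \<epsilon> / (4 * (\<bar>I\<bar> + 1))"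
  have "e > 0"
    using \<open>\<epsilon> > 0\<close> by (simp add: e_def)
  then obtain G where G: "\<And>x. x \<in> cbox a b \<Longrightarrow> norm (F x - G x) \<le> e * w x"
    and "G integrable_on cbox a b"
    using approx by blast
  then obtain \<gamma>1 where "gauge \<gamma>1" and \<gamma>1: "\<And>D1 D2. D1 tagged_division_of cbox a b \<Longrightarrow> \<gamma>1 fine D1 \<Longrightarrow>
      D2 tagged_division_of cbox a b \<Longrightarrow> \<gamma>1 fine D2 \<Longrightarrow> norm (tagged_sum G D1 - tagged_sum G D2) < \<epsilon>/2"
    using \<open>\<epsilon> > 0\<close> unfolding integrable_Cauchy by (meson half_gt_zero)
  obtain \<gamma>2 where "gauge \<gamma>2"
    and \<gamma>2: "\<And>D. D tagged_division_of cbox a b \<Longrightarrow> \<gamma>2 fine D \<Longrightarrow> norm (tagged_sum w D - I) < 1"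
    using integrable_integral[OF w, unfolded has_integral, rule_format, of 1] by (auto simp: I_def)
  have close: "norm (tagged_sum F D - tagged_sum G D) \<le> \<epsilon>/4" if D: "D tagged_division_of cbox a b" "\<gamma>2 fine D" for D
  proof -
    have "norm (tagged_sum F D - tagged_sum G D) \<le> e * tagged_sum w D"
      by (rule norm_tagged_sum_diff_le[OF D(1) G])
    also have "\<dots> \<le> e * (\<bar>I\<bar> + 1)"
      using \<gamma>2[OF D] \<open>e > 0\<close> by (intro mult_left_mono) (auto simp: abs_le_iff)
    also have "\<dots> = \<epsilon>/4"
      by (simp add: e_def field_simps)
    finally show ?thesis .
  qed
  show "\<exists>\<gamma>. gauge \<gamma> \<and> (\<forall>D1 D2. D1 tagged_division_of cbox a b \<and> \<gamma> fine D1 \<and>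
      D2 tagged_division_of cbox a b \<and> \<gamma> fine D2 \<longrightarrow> norm (tagged_sum F D1 - tagged_sum F D2) < \<epsilon>)"
  proof (intro exI conjI allI impI)
    show "gauge (\<lambda>x. \<gamma>1 x \<inter> \<gamma>2 x)"
      using \<open>gauge \<gamma>1\<close> \<open>gauge \<gamma>2\<close> by blast
    fix D1 D2
    assume "D1 tagged_division_of cbox a b \<and> (\<lambda>x. \<gamma>1 x \<inter> \<gamma>2 x) fine D1 \<and>
      D2 tagged_division_of cbox a b \<and> (\<lambda>x. \<gamma>1 x \<inter> \<gamma>2 x) fine D2"
    then have D: "D1 tagged_division_of cbox a b" "\<gamma>1 fine D1" "\<gamma>2 fine D1"
      "D2 tagged_division_of cbox a b" "\<gamma>1 fine D2" "\<gamma>2 fine D2"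
      by (auto simp: fine_Int)
    let ?F1 = "tagged_sum F D1" and ?F2 = "tagged_sum F D2"
      and ?G1 = "tagged_sum G D1" and ?G2 = "tagged_sum G D2"
    have "?F1 - ?F2 = ((?F1 - ?G1) + (?G1 - ?G2)) - (?F2 - ?G2)"
      by (simp add: algebra_simps)
    then have "norm (?F1 - ?F2) \<le> norm ((?F1 - ?G1) + (?G1 - ?G2)) + norm (?F2 - ?G2)"
      by (metis norm_triangle_ineq4)
    also have "\<dots> \<le> norm (?F1 - ?G1) + norm (?G1 - ?G2) + norm (?F2 - ?G2)"
      using norm_triangle_ineq[of "?F1 - ?G1" "?G1 - ?G2"] by linarith
    also have "\<dots> < \<epsilon>"
      using close[OF D(1,3)] close[OF D(4,6)] \<gamma>1[OF D(1,2,4,5)] by linarith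
    finally show "norm (?F1 - ?F2) < \<epsilon>" .
  qed
qed

lemma integrable_bilinear_continuous:
  fixes f :: "real \<Rightarrow> 'b::euclidean_space" and h :: "real \<Rightarrow> 'c::real_normed_vector"
    and prod :: "'b \<Rightarrow> 'c \<Rightarrow> 'd::banach"
  assumes "bounded_bilinear prod"
    and f: "f absolutely_integrable_on {a..b}" and h: "continuous_on {a..b} h"
  shows "(\<lambda>x. prod (f x) (h x)) integrable_on {a..b}"
proof -
  interpret bounded_bilinear prod by fact
  obtain B where "B > 0" and B: "\<And>u v. norm (prod u v) \<le> norm u * norm v * B"
    using pos_bounded by blast
  have fi: "f integrable_on cbox a b" and nfi: "(\<lambda>x. norm (f x)) integrable_on cbox a b"
    using f by (auto simp: absolutely_integrable_on_def)
  show ?thesis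
    unfolding box_real(2)[symmetric]
  proof (rule integrable_weighted_limit[OF nfi])
    fix e :: real assume "e > 0"
    then obtain d where "0 < d" and d: "\<And>x x'. \<lbrakk>x \<in> cbox a b; x' \<in> cbox a b; dist x' x < d\<rbrakk>
        \<Longrightarrow> dist (h x') (h x) < e / B"
      using compact_uniformly_continuous[OF h[unfolded box_real(2)[symmetric]] compact_cbox] \<open>B > 0\<close>
      unfolding uniformly_continuous_on_def by (metis divide_pos_pos)
    obtain p where ptag: "p tagged_division_of cbox a b" and finep: "(\<lambda>x. ball x d) fine p"
      using fine_division_exists[OF gauge_ball[OF \<open>0 < d\<close>], of a b] .
    txt \<open>On each tile freeze \<open>h\<close> at the tag.\<close>
    have "\<exists>g. (\<forall>y\<in>l. norm (prod (f y) (h y) - g y) \<le> e * norm (f y)) \<and> g integrable_on l"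
      if xl: "(x, l) \<in> p" for x l
    proof (intro exI conjI ballI)
      obtain u v where "l = cbox u v"
        using xl ptag by blast
      moreover have "x \<in> l" "l \<subseteq> cbox a b"
        using xl ptag by blast+
      ultimately have "f integrable_on l"
        using integrable_on_subcbox[OF fi] by blast
      from integrable_linear[OF this bounded_linear_left[of "h x"]]
      show "(\<lambda>y. prod (f y) (h x)) integrable_on l"
        by (simp add: o_def)
      fix y assume "y \<in> l"
      moreover have "l \<subseteq> ball x d"
        using finep xl by (auto simp: fine_def)
      ultimately have "dist y x < d"
        by (auto simp: dist_commute)
      then have "dist (h y) (h x) < e / B"
        using d \<open>x \<in> l\<close> \<open>y \<in> l\<close> \<open>l \<subseteq> cbox a b\<close> by blast
      then have "norm (h y - h x) * B \<le> e"
        using \<open>B > 0\<close> by (simp add: dist_norm field_simps)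
      have "norm (prod (f y) (h y) - prod (f y) (h x)) \<le> norm (f y) * norm (h y - h x) * B"
        using B[of "f y" "h y - h x"] by (simp add: diff_right)
      also have "\<dots> \<le> e * norm (f y)"
        using mult_left_mono[OF \<open>norm (h y - h x) * B \<le> e\<close> norm_ge_zero[of "f y"]]
        by (simp add: mult_ac)
      finally show "norm (prod (f y) (h y) - prod (f y) (h x)) \<le> e * norm (f y)" .
    qed
    then have "\<forall>l\<in>snd ` p. \<exists>g. (\<forall>y\<in>l. norm (prod (f y) (h y) - g y) \<le> e * norm (f y))
        \<and> g integrable_on l"
      by force
    then show "\<exists>G. (\<forall>x\<in>cbox a b. norm (prod (f x) (h x) - G x) \<le> e * norm (f x)) \<and> G integrable_on cbox a b"
      using \<open>e > 0\<close>
      by (intro approximable_weighted_on_division[OF _ _ division_of_tagged_division[OF ptag]]) auto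
  qed
qed

section \<open>Volterra equations of the second kind\<close>

lemma has_integral_power_Icc0:
  assumes "0 \<le> t"
  shows "((\<lambda>s. s ^ n) has_integral t ^ Suc n / Suc n) {0..t}"
proof -
  have "((\<lambda>s. s ^ n) has_integral t ^ Suc n / Suc n - 0 ^ Suc n / Suc n) {0..t}"
  proof (rule fundamental_theorem_of_calculus[OF assms])
    fix s :: real
    have "((\<lambda>s. s ^ Suc n / Suc n) has_real_derivative s ^ n) (at s within {0..t})"
      by (rule derivative_eq_intros refl | simp)+
    then show "((\<lambda>s. s ^ Suc n / Suc n) has_vector_derivative s ^ n) (at s within {0..t})"
      by (simp add: has_real_derivative_iff_has_vector_derivative)
  qed
  then show ?thesis
    by simp
qed

definition conv :: "(real \<Rightarrow> complex) \<Rightarrow> (real \<Rightarrow> complex) \<Rightarrow> real \<Rightarrow> complex" where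
  "conv k f t = integral {0..t} (\<lambda>s. f (t - s) * k s)"

lemma conv_reflect: "conv k f t = integral {0..t} (\<lambda>s. f s * k (t - s))"
  using integral_reflect_interval[where f = "\<lambda>s. f s * k (t - s)" and t = t] by (simp add: conv_def)

lemma conv_integrable:
  fixes f k :: "real \<Rightarrow> complex"
  assumes "f absolutely_integrable_on {0..t}" and "continuous_on {0..t} k"
  shows "(\<lambda>s. f (t - s) * k s) integrable_on {0..t}"
  using assms integrable_bilinear_continuous[OF bounded_bilinear_mult,
      where f = "\<lambda>s. f (t - s)" and h = k and a = 0 and b = t]
  by (simp add: absolutely_integrable_reflect_interval)

lemma conv_diff:
  fixes k :: "real \<Rightarrow> complex"
  assumes "f1 absolutely_integrable_on {0..t}" "f2 absolutely_integrable_on {0..t}"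
    and "continuous_on {0..t} k"
  shows "conv k f1 t - conv k f2 t = conv k (\<lambda>s. f1 s - f2 s) t"
  unfolding conv_def
  by (simp add: integral_diff[OF conv_integrable[OF assms(1,3)] conv_integrable[OF assms(2,3)], symmetric]
      left_diff_distrib)

lemma norm_conv_le:
  fixes k :: "real \<Rightarrow> complex"
  assumes f: "f absolutely_integrable_on {0..t}" and k: "continuous_on {0..t} k"
    and M: "\<And>s. s \<in> {0..t} \<Longrightarrow> norm (k s) \<le> M"
  shows "norm (conv k f t) \<le> M * integral {0..t} (\<lambda>s. norm (f s))"
proof -
  have "norm (conv k f t) \<le> integral {0..t} (\<lambda>s. M * norm (f (t - s)))"
    unfolding conv_def
  proof (rule integral_norm_bound_integral)
    show "(\<lambda>s. f (t - s) * k s) integrable_on {0..t}"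
      by (rule conv_integrable[OF f k])
    show "(\<lambda>s. M * norm (f (t - s))) integrable_on {0..t}"
      using f by (intro integrable_on_mult_right)
        (simp add: integrable_reflect_interval[where f = "\<lambda>s. norm (f s)"] absolutely_integrable_on_def)
    show "norm (f (t - s) * k s) \<le> M * norm (f (t - s))" if "s \<in> {0..t}" for s
      using mult_left_mono[OF M[OF that] norm_ge_zero[of "f (t - s)"]] by (simp add: norm_mult mult_ac)
  qed
  then show ?thesis
    using integral_reflect_interval[where f = "\<lambda>s. norm (f s)" and t = t] by simp
qed

text \<open>The substitution \<open>s = t * r\<close> moves the dependence on \<open>t\<close> from the domain of integration
  into the integrand, where \<open>integral_continuous_on_param\<close> applies.\<close>
lemma continuous_on_conv:
  assumes f: "continuous_on {0..} f" and k: "continuous_on {0..} k"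
  shows "continuous_on {0..} (conv k f)"
proof -
  define J where "J t = integral {0..1} (\<lambda>r. f (t - t * r) * k (t * r))" for t :: real
  have "continuous_on ({0..} \<times> cbox 0 1) (\<lambda>(t, r). f (t - t * r) * k (t * r))"
    unfolding case_prod_unfold
  proof (intro continuous_on_mult continuous_on_compose2[OF f] continuous_on_compose2[OF k]
      continuous_intros)
    have "a * b \<le> a" if "0 \<le> a" "b \<le> 1" for a b :: real
      using mult_left_mono[of b 1 a] that by simp
    then show "(\<lambda>p::real\<times>real. fst p - fst p * snd p) ` ({0..} \<times> cbox 0 1) \<subseteq> {0..}"
      by auto
    show "(\<lambda>p::real\<times>real. fst p * snd p) ` ({0..} \<times> cbox 0 1) \<subseteq> {0..}"
      by auto
  qed
  then have "continuous_on {0..} J"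
    unfolding J_def box_real(2)[symmetric] by (rule integral_continuous_on_param)
  then have "continuous_on {0..} (\<lambda>t. t *\<^sub>R J t)"
    by (intro continuous_intros)
  moreover have "conv k f t = t *\<^sub>R J t" if "t \<in> {0..}" for t
  proof (cases "t = 0")
    case False
    with that have "t > 0"
      by simp
    have "continuous_on {0..t} (\<lambda>s. f (t - s) * k s)"
      by (intro continuous_on_mult continuous_on_compose2[OF f] continuous_on_subset[OF k]
          continuous_intros) auto
    then have "((\<lambda>s. f (t - s) * k s) has_integral conv k f t) (cbox 0 t)"
      unfolding conv_def box_real(2) by (intro integrable_integral integrable_continuous_interval)
    from has_integral_affinity[OF this, of t 0]
    have "((\<lambda>r. f (t - t * r) * k (t * r)) has_integral conv k f t /\<^sub>R t) {0..1}"
      using \<open>t > 0\<close> by (simp add: image_affinity_cbox divide_inverse_commute)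
    then show ?thesis
      using \<open>t > 0\<close> by (simp add: J_def integral_unique)
  qed (simp add: conv_def)
  ultimately show ?thesis
    by (metis (no_types, lifting) continuous_on_eq)
qed

lemma iterated_integral_bound:
  fixes E :: "nat \<Rightarrow> real \<Rightarrow> 'b::real_normed_vector"
  assumes "0 \<le> M" "0 \<le> C"
    and E0: "\<And>t. t \<in> {0..T} \<Longrightarrow> norm (E 0 t) \<le> C"
    and step: "\<And>n t. t \<in> {0..T} \<Longrightarrow> norm (E (Suc n) t) \<le> M * integral {0..t} (\<lambda>s. norm (E n s))"
    and int: "\<And>n t. t \<in> {0..T} \<Longrightarrow> (\<lambda>s. norm (E n s)) integrable_on {0..t}"
  shows "t \<in> {0..T} \<Longrightarrow> norm (E n t) \<le> C * (M * t) ^ n / fact n"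
proof (induction n arbitrary: t)
  case 0
  then show ?case
    using E0 by simp
next
  case (Suc n)
  define c where "c = C * M ^ n / fact n"
  have "0 \<le> t"
    using Suc.prems by simp
  have c_pow: "((\<lambda>s. c * s ^ n) has_integral c * (t ^ Suc n / Suc n)) {0..t}"
    by (intro has_integral_mult_right has_integral_power_Icc0 \<open>0 \<le> t\<close>)
  have "integral {0..t} (\<lambda>s. norm (E n s)) \<le> integral {0..t} (\<lambda>s. c * s ^ n)"
  proof (rule integral_le[OF int[OF Suc.prems]])
    show "(\<lambda>s. c * s ^ n) integrable_on {0..t}"
      using c_pow by blast
    show "norm (E n s) \<le> c * s ^ n" if "s \<in> {0..t}" for s
      using Suc.IH[of s] that Suc.prems by (simp add: c_def power_mult_distrib)
  qed
  also have "\<dots> = c * (t ^ Suc n / Suc n)"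
    using c_pow by (rule integral_unique)
  finally have "M * integral {0..t} (\<lambda>s. norm (E n s)) \<le> M * (c * (t ^ Suc n / Suc n))"
    using \<open>0 \<le> M\<close> by (rule mult_left_mono)
  also have "\<dots> = C * (M * t) ^ Suc n / fact (Suc n)"
    by (simp add: c_def power_mult_distrib field_simps)
  finally show ?case
    using step[OF Suc.prems, of n] by linarith
qed

lemma volterra_unique:
  assumes k: "continuous_on {0..} k"
    and int: "\<And>t. t \<ge> 0 \<Longrightarrow> K1 absolutely_integrable_on {0..t}"
      "\<And>t. t \<ge> 0 \<Longrightarrow> K2 absolutely_integrable_on {0..t}"
    and eq: "\<And>t. t \<ge> 0 \<Longrightarrow> K1 t = g t - conv k K1 t"
      "\<And>t. t \<ge> 0 \<Longrightarrow> K2 t = g t - conv k K2 t"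
    and "0 \<le> T"
  shows "K1 T = K2 T"
proof -
  define D where "D t = K1 t - K2 t" for t
  have D_int: "D absolutely_integrable_on {0..t}" if "t \<ge> 0" for t
    unfolding D_def using int[OF that] by (rule set_integral_diff(1))
  have D_eq: "D t = - conv k D t" if "t \<ge> 0" for t
  proof -
    have "D t = - (conv k K1 t - conv k K2 t)"
      using eq[OF that] by (simp add: D_def)
    also have "\<dots> = - conv k D t"
      using conv_diff[OF int[OF that] continuous_on_subset[OF k]] by (simp add: D_def[abs_def])
    finally show ?thesis .
  qed
  obtain M where "0 \<le> M" and M: "\<And>s. s \<in> {0..T} \<Longrightarrow> norm (k s) \<le> M"
    using continuous_on_compact_bound[OF compact_Icc continuous_on_subset[OF k]] by auto
  define B where "B = integral {0..T} (\<lambda>s. norm (D s))"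
  have step: "norm (D t) \<le> M * integral {0..t} (\<lambda>s. norm (D s))" if "t \<in> {0..T}" for t
    using D_eq[of t] that M
    by (auto intro!: norm_conv_le[OF D_int continuous_on_subset[OF k]])
  have D_norm_int: "(\<lambda>s. norm (D s)) integrable_on {0..t}" if "t \<ge> 0" for t
    using D_int[OF that] by (simp add: absolutely_integrable_on_def)
  have "integral {0..t} (\<lambda>s. norm (D s)) \<le> B" if "t \<in> {0..T}" for t
    unfolding B_def using that \<open>0 \<le> T\<close>
    by (intro integral_subset_le D_norm_int) auto
  then have "norm (D t) \<le> M * B" if "t \<in> {0..T}" for t
    using step[OF that] that mult_left_mono[OF _ \<open>0 \<le> M\<close>] order_trans by blast
  moreover have "0 \<le> B"
    unfolding B_def using D_norm_int[OF \<open>0 \<le> T\<close>] by (intro integral_nonneg) auto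
  ultimately have "norm (D T) \<le> M * B * (M * T) ^ n / fact n" for n
    using \<open>0 \<le> M\<close> \<open>0 \<le> T\<close> D_norm_int step
    by (intro iterated_integral_bound[where E = "\<lambda>_. D"]) auto
  moreover have "(\<lambda>n. M * B * (M * T) ^ n / fact n) \<longlonglongrightarrow> 0"
    using tendsto_mult_right_zero[OF summable_LIMSEQ_zero[OF summable_exp[of "M * T"]], of "M * B"]
    by (simp add: field_simps)
  ultimately have "norm (D T) \<le> 0"
    by (intro LIMSEQ_le_const[where X = "\<lambda>n. M * B * (M * T) ^ n / fact n"]) auto
  then show ?thesis
    by (simp add: D_def)
qed

fun picard :: "(real \<Rightarrow> complex) \<Rightarrow> (real \<Rightarrow> complex) \<Rightarrow> nat \<Rightarrow> real \<Rightarrow> complex" where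
  "picard k g 0 = g"
| "picard k g (Suc n) = (\<lambda>t. g t - conv k (picard k g n) t)"

lemma continuous_on_picard:
  assumes "continuous_on {0..} k" and "continuous_on {0..} g"
  shows "continuous_on {0..} (picard k g n)"
  by (induction n) (auto intro!: continuous_intros continuous_on_conv assms)

lemma picard_increment_bound:
  assumes k: "continuous_on {0..} k" and g: "continuous_on {0..} g" and "0 \<le> T"
  obtains a where "summable a"
    and "\<And>n t. t \<in> {0..T} \<Longrightarrow> norm (picard k g (Suc n) t - picard k g n t) \<le> a n"
proof -
  define E where "E n t = picard k g (Suc n) t - picard k g n t" for n t
  have P_int: "picard k g n absolutely_integrable_on {0..t}" for n t
    by (rule absolutely_integrable_on_Icc0[OF continuous_on_picard[OF k g]])
  have E_cont: "continuous_on {0..} (E n)" for n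
    unfolding E_def by (intro continuous_intros continuous_on_picard k g)
  have E_int: "E n absolutely_integrable_on {0..t}" for n t
    by (rule absolutely_integrable_on_Icc0[OF E_cont])
  obtain M where "0 \<le> M" and M: "\<And>s. s \<in> {0..T} \<Longrightarrow> norm (k s) \<le> M"
    using continuous_on_compact_bound[OF compact_Icc continuous_on_subset[OF k]] by auto
  obtain C where "0 \<le> C" and C: "\<And>s. s \<in> {0..T} \<Longrightarrow> norm (E 0 s) \<le> C"
    using continuous_on_compact_bound[OF compact_Icc continuous_on_subset[OF E_cont[of 0]]] by auto
  have "E (Suc n) t = - conv k (E n) t" for n t
  proof -
    have "E (Suc n) t = - (conv k (picard k g (Suc n)) t - conv k (picard k g n) t)"
      by (simp add: E_def)
    also have "\<dots> = - conv k (E n) t"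
      using continuous_on_subset[OF k, of "{0..t}"]
      by (simp add: conv_diff[OF P_int P_int] E_def[abs_def] del: picard.simps)
    finally show ?thesis .
  qed
  then have "norm (E (Suc n) t) \<le> M * integral {0..t} (\<lambda>s. norm (E n s))" if "t \<in> {0..T}" for n t
    using that M by (auto intro!: norm_conv_le[OF E_int continuous_on_subset[OF k]])
  then have bound: "norm (E n t) \<le> C * (M * t) ^ n / fact n" if "t \<in> {0..T}" for n t
    using that \<open>0 \<le> M\<close> \<open>0 \<le> C\<close> C E_int
    by (intro iterated_integral_bound[where E = E and T = T]) (auto simp: absolutely_integrable_on_def)
  show ?thesis
  proof
    show "summable (\<lambda>n. C * (M * T) ^ n / fact n)"
      using summable_mult[OF summable_exp[of "M * T"], of C] by (simp add: divide_inverse mult_ac)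
    fix n t assume "t \<in> {0..T}"
    then have "C * (M * t) ^ n / fact n \<le> C * (M * T) ^ n / fact n"
      using \<open>0 \<le> M\<close> \<open>0 \<le> C\<close>
      by (intro divide_right_mono mult_left_mono power_mono) (auto intro: mult_left_mono)
    then show "norm (picard k g (Suc n) t - picard k g n t) \<le> C * (M * T) ^ n / fact n"
      using bound[OF \<open>t \<in> {0..T}\<close>, of n] unfolding E_def by linarith
  qed
qed

lemma uniform_limit_picard:
  assumes k: "continuous_on {0..} k" and g: "continuous_on {0..} g"
  obtains K where "\<And>T. 0 \<le> T \<Longrightarrow> uniform_limit {0..T} (picard k g) K sequentially"
proof (rule that)
  fix T :: real assume "0 \<le> T"
  define E where "E n t = picard k g (Suc n) t - picard k g n t" for n t
  obtain a where "summable a" and "\<And>n t. t \<in> {0..T} \<Longrightarrow> norm (E n t) \<le> a n"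
    using picard_increment_bound[OF k g \<open>0 \<le> T\<close>] unfolding E_def by blast
  then have "uniform_limit {0..T} (\<lambda>n t. g t + (\<Sum>i<n. E i t)) (\<lambda>t. g t + (\<Sum>i. E i t)) sequentially"
    by (intro uniform_limit_add uniform_limit_const Weierstrass_m_test)
  moreover have "(\<lambda>n t. g t + (\<Sum>i<n. E i t)) = picard k g"
    by (simp add: E_def fun_eq_iff sum_lessThan_telescope[where f = "\<lambda>i. picard k g i _"]
        del: picard.simps(2))
  ultimately show "uniform_limit {0..T} (picard k g) (\<lambda>t. g t + (\<Sum>i. E i t)) sequentially"
    by simp
qed

lemma tendsto_conv_uniform_limit:
  assumes lim: "uniform_limit {0..t} F f sequentially"
    and F: "\<And>n. continuous_on {0..t} (F n)" and k: "continuous_on {0..t} k"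
  shows "(\<lambda>n. conv k (F n) t) \<longlonglongrightarrow> conv k f t"
proof -
  have k': "continuous_on {0..t} (\<lambda>s. k (t - s))"
    by (intro continuous_on_compose2[OF k] continuous_intros) auto
  have "continuous_on {0..t} f"
    using F by (intro uniform_limit_theorem[OF _ lim]) auto
  then have "uniform_limit {0..t} (\<lambda>n s. F n s * k (t - s)) (\<lambda>s. f s * k (t - s)) sequentially"
    using k' by (intro uniform_lim_mult lim uniform_limit_const compact_imp_bounded
        compact_continuous_image compact_Icc)
  then obtain I J where I: "\<And>n. ((\<lambda>s. F n s * k (t - s)) has_integral I n) {0..t}"
    and J: "((\<lambda>s. f s * k (t - s)) has_integral J) {0..t}" and "I \<longlonglongrightarrow> J"
    by (rule uniform_limit_integral) (auto intro!: continuous_on_mult F k')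
  moreover have "I = (\<lambda>n. conv k (F n) t)" "J = conv k f t"
    by (simp_all add: fun_eq_iff conv_reflect integral_unique[OF I] integral_unique[OF J])
  ultimately show ?thesis
    by simp
qed

lemma volterra_exists:
  assumes k: "continuous_on {0..} k" and g: "continuous_on {0..} g"
  obtains K where "continuous_on {0..} K" and "\<And>t. t \<ge> 0 \<Longrightarrow> K t = g t - conv k K t"
proof -
  obtain K where K: "\<And>T. 0 \<le> T \<Longrightarrow> uniform_limit {0..T} (picard k g) K sequentially"
    using uniform_limit_picard[OF k g] by blast
  have P: "continuous_on {0..T} (picard k g n)" for n T
    by (rule continuous_on_subset[OF continuous_on_picard[OF k g]]) auto
  have "continuous_on {0..T} K" for T
    using uniform_limit_theorem[OF _ K[of T]] P by (cases "0 \<le> T") auto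
  moreover have "K t = g t - conv k K t" if "t \<ge> 0" for t
  proof (rule LIMSEQ_unique)
    show "(\<lambda>n. picard k g (Suc n) t) \<longlonglongrightarrow> K t"
      using that by (intro LIMSEQ_Suc[OF tendsto_uniform_limitI[OF K[OF that]]]) auto
    show "(\<lambda>n. picard k g (Suc n) t) \<longlonglongrightarrow> g t - conv k K t"
      using that
      by (auto intro!: tendsto_diff tendsto_conv_uniform_limit K P continuous_on_subset[OF k])
  qed
  ultimately show ?thesis
    using that continuous_on_atLeast_if_Icc by blast
qed

section \<open>The memory kernel of a strongly continuous semigroup\<close>

definition correlation :: "(real \<Rightarrow> 'a::complex_hilbert \<Rightarrow> 'a) \<Rightarrow> 'a \<Rightarrow> 'a \<Rightarrow> real \<Rightarrow> complex" where
  "correlation U z x t = cinner (U t x) (projQ z (adj (gen_dom U) (gen U) z)) / cinner z z"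

lemma volterra_eq_iff_conv:
  "volterra_eq U z K t \<longleftrightarrow> K t = correlation U z (projQ z (gen U z)) t - conv (correlation U z z) K t"
  by (simp add: volterra_eq_def conv_def correlation_def)

context
  fixes U :: "real \<Rightarrow> 'a::complex_hilbert \<Rightarrow> 'a"
  assumes semigroup: "C0_semigroup U"
begin

lemma semigroup_bounded_linear: "t \<ge> 0 \<Longrightarrow> bounded_linear (U t)"
  using semigroup by (simp add: C0_semigroup_def)

lemma semigroup_zero: "U 0 x = x"
  using semigroup by (simp add: C0_semigroup_def)

lemma semigroup_add: "s \<ge> 0 \<Longrightarrow> t \<ge> 0 \<Longrightarrow> U (s + t) x = U s (U t x)"
  using semigroup by (simp add: C0_semigroup_def)

lemma semigroup_continuous: "continuous_on {0..} (\<lambda>t. U t x)"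
  using semigroup by (simp add: C0_semigroup_def)

lemma semigroup_right_quotient:
  assumes z: "z \<in> gen_dom U" and t: "t \<ge> 0"
  shows "((\<lambda>h. (1/h) *\<^sub>R (U (t+h) z - U t z)) \<longlongrightarrow> U t (gen U z)) (at_right 0)"
proof -
  obtain y where y: "((\<lambda>h. (1 / h) *\<^sub>R (U h z - z)) \<longlongrightarrow> y) (at_right 0)"
    using z by (auto simp: gen_dom_def)
  moreover have "gen U z = y"
    unfolding gen_def using y by (intro tendsto_Lim) auto
  ultimately have gen: "((\<lambda>h. (1 / h) *\<^sub>R (U h z - z)) \<longlongrightarrow> gen U z) (at_right 0)"
    by simp
  interpret Ut: bounded_linear "U t"
    by (rule semigroup_bounded_linear[OF t])
  have "\<forall>\<^sub>F h in at_right 0. U t ((1 / h) *\<^sub>R (U h z - z)) = (1/h) *\<^sub>R (U (t+h) z - U t z)"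
    by (auto simp: eventually_at_right_field semigroup_add t Ut.scaleR Ut.diff
        intro!: exI[of _ 1])
  with Ut.tendsto[OF gen] show ?thesis
    by (rule Lim_transform_eventually)
qed

text \<open>The semigroup law only gives the right derivative. Instead of bounding \<open>U\<close> uniformly to get
  the left one, compare with \<open>G t = z + integral {0..t} (\<lambda>s. U s (gen U z))\<close>: the difference
  \<open>U t z - G t\<close> is continuous with vanishing right derivative, hence zero.\<close>
lemma semigroup_has_vector_derivative:
  assumes z: "z \<in> gen_dom U" and t: "t \<ge> 0"
  shows "((\<lambda>s. U s z) has_vector_derivative U t (gen U z)) (at t within {0..})"
proof -
  define G where "G t = z + integral {0..t} (\<lambda>s. U s (gen U z))" for t
  have G: "(G has_vector_derivative U s (gen U z)) (at s within {0..})" if "s \<ge> 0" for s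
  proof -
    have "((\<lambda>u. integral {0..u} (\<lambda>s. U s (gen U z))) has_vector_derivative U s (gen U z))
        (at s within {0..s+1})"
      using that by (intro integral_has_vector_derivative continuous_on_subset[OF semigroup_continuous]) auto
    then show ?thesis
      unfolding G_def by (auto intro: derivative_eq_intros simp: at_within_Icc_eq_atLeast)
  qed
  have "U s z - G s = U 0 z - G 0" if "s \<ge> 0" for s
  proof (rule right_derivative_zero_imp_const[OF _ _ that])
    have "continuous_on {0..} G"
      unfolding continuous_on_eq_continuous_within using G by (auto intro: has_vector_derivative_continuous)
    then show "continuous_on {0..} (\<lambda>s. U s z - G s)"
      by (intro continuous_intros semigroup_continuous)
    fix u :: real assume "u \<ge> 0"
    then have "(G has_vector_derivative U u (gen U z)) (at u within {u..})"
      by (intro has_vector_derivative_within_subset[OF G]) auto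
    from tendsto_diff[OF semigroup_right_quotient[OF z \<open>u \<ge> 0\<close>]
        has_vector_derivative_imp_right_quotient[OF this]]
    show "((\<lambda>h. (1/h) *\<^sub>R ((U (u+h) z - G (u+h)) - (U u z - G u))) \<longlongrightarrow> 0) (at_right 0)"
      by (simp add: algebra_simps)
  qed
  then have "U s z = G s" if "s \<in> {0..}" for s
    using that by (simp add: G_def semigroup_zero)
  then show ?thesis
    using has_vector_derivative_transform[OF _ _ G[OF t]] t by auto
qed

lemma semigroup_has_vector_derivative_iff:
  assumes "z \<in> gen_dom U" and "t \<ge> 0"
  shows "((\<lambda>s. U s z) has_vector_derivative y) (at t within {0..}) \<longleftrightarrow> y = U t (gen U z)"
  using vector_derivative_unique_within[OF at_within_atLeast_nontrivial]
    semigroup_has_vector_derivative[OF assms] assms(2) by blast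

lemma continuous_on_correlation: "continuous_on {0..} (correlation U z x)"
  unfolding correlation_def divide_inverse
  by (intro continuous_intros bounded_linear.continuous_on[OF bounded_linear_cinner_left]
      semigroup_continuous)

lemma correlation_integral:
  assumes "K absolutely_integrable_on {0..t}"
  shows "cinner (integral {0..t} (\<lambda>s. K (t - s) *\<^sub>C U s z)) (projQ z (adj (gen_dom U) (gen U) z))
      / cinner z z = conv (correlation U z z) K t"
proof -
  let ?v = "projQ z (adj (gen_dom U) (gen U) z)"
  have "(\<lambda>s. K (t - s) *\<^sub>C U s z) integrable_on {0..t}"
    using assms continuous_on_subset[OF semigroup_continuous]
    by (intro integrable_bilinear_continuous[OF bounded_bilinear_cscale])
      (auto simp: absolutely_integrable_reflect_interval)
  then have "cinner (integral {0..t} (\<lambda>s. K (t - s) *\<^sub>C U s z)) ?v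
      = integral {0..t} (\<lambda>s. K (t - s) * cinner (U s z) ?v)"
    by (simp add: integral_linear[OF _ bounded_linear_cinner_left, symmetric] o_def cinner_cscale_left)
  then show ?thesis
    by (simp add: conv_def correlation_def)
qed

lemma volterra_eq_solvable:
  obtains K where "continuous_on {0..} K" and "\<And>t. t \<ge> 0 \<Longrightarrow> volterra_eq U z K t"
  using volterra_exists[OF continuous_on_correlation continuous_on_correlation]
  by (metis volterra_eq_iff_conv)

lemma volterra_eq_unique:
  assumes K1: "\<And>t. t \<ge> 0 \<Longrightarrow> K1 absolutely_integrable_on {0..t} \<and> volterra_eq U z K1 t"
    and K2: "\<And>t. t \<ge> 0 \<Longrightarrow> K2 absolutely_integrable_on {0..t} \<and> volterra_eq U z K2 t"
    and "t \<ge> 0"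
  shows "K1 t = K2 t"
proof (rule volterra_unique[OF continuous_on_correlation _ _ _ _ \<open>t \<ge> 0\<close>,
      where g = "correlation U z (projQ z (gen U z))"])
  fix s :: real assume "s \<ge> 0"
  then show "K1 absolutely_integrable_on {0..s}" "K2 absolutely_integrable_on {0..s}"
    "K1 s = correlation U z (projQ z (gen U z)) s - conv (correlation U z z) K1 s"
    "K2 s = correlation U z (projQ z (gen U z)) s - conv (correlation U z z) K2 s"
    using K1 K2 by (simp_all add: volterra_eq_iff_conv)
qed

lemma gle_system_iff_volterra:
  assumes z: "z \<in> gen_dom U"
  shows "gle_system U z K \<eta> \<longleftrightarrow> (\<forall>t\<ge>0. K absolutely_integrable_on {0..t} \<and> volterra_eq U z K t
    \<and> \<eta> t = U t (projQ z (gen U z)) - integral {0..t} (\<lambda>s. K (t - s) *\<^sub>C U s z))"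
proof -
  define I where "I t = integral {0..t} (\<lambda>s. K (t - s) *\<^sub>C U s z)" for t
  have derivative_iff: "((\<lambda>s. U s z) has_vector_derivative (U t (projP z (gen U z)) + \<eta> t + I t))
      (at t within {0..}) \<longleftrightarrow> \<eta> t = U t (projQ z (gen U z)) - I t" if "t \<ge> 0" for t
  proof -
    have "U t (gen U z) = U t (projP z (gen U z)) + U t (projQ z (gen U z))"
      using linear_add[OF bounded_linear.linear[OF semigroup_bounded_linear[OF that]],
          of "projP z (gen U z)" "projQ z (gen U z)"]
      by (simp add: projQ_def)
    then show ?thesis
      by (simp add: semigroup_has_vector_derivative_iff[OF z that] add.assoc eq_diff_eq)
  qed
  have kernel_iff: "K t = cinner (\<eta> t) (projQ z (adj (gen_dom U) (gen U) z)) / cinner z z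
      \<longleftrightarrow> volterra_eq U z K t"
    if "K absolutely_integrable_on {0..t}" and "\<eta> t = U t (projQ z (gen U z)) - I t" for t
    using that correlation_integral[OF that(1)]
    by (simp add: volterra_eq_iff_conv correlation_def I_def linear_diff[OF linear_cinner_left]
        diff_divide_distrib)
  show ?thesis
    unfolding gle_system_def I_def[symmetric] using derivative_iff kernel_iff by blast
qed

end

theorem proposition2:
  fixes U :: "real \<Rightarrow> 'a::complex_hilbert \<Rightarrow> 'a" and z :: 'a
  assumes "C0_semigroup U"
    and "z \<in> gen_dom U"
    and "z \<in> adj_dom (gen_dom U) (gen U)"
    and "z \<noteq> 0"
  shows "\<exists>K \<eta>. gle_system U z K \<eta>
           \<and> (\<forall>K' \<eta>'. gle_system U z K' \<eta>' \<longrightarrow> (\<forall>t\<ge>0. K' t = K t \<and> \<eta>' t = \<eta> t))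
           \<and> continuous_on {0..} K
           \<and> (\<forall>t\<ge>0. volterra_eq U z K t)
           \<and> (\<forall>K'. continuous_on {0..} K' \<and> (\<forall>t\<ge>0. volterra_eq U z K' t)
                  \<longrightarrow> (\<forall>t\<ge>0. K' t = K t))
           \<and> (\<forall>t\<ge>0. \<eta> t = U t (projQ z (gen U z)) - integral {0..t} (\<lambda>s. K (t - s) *\<^sub>C U s z))"
proof -
  note gle = gle_system_iff_volterra[OF assms(1,2)]
  obtain K where "continuous_on {0..} K" and K: "\<And>t. t \<ge> 0 \<Longrightarrow> volterra_eq U z K t"
    using volterra_eq_solvable[OF assms(1)] by blast
  have K_int: "K absolutely_integrable_on {0..t}" for t
    by (rule absolutely_integrable_on_Icc0[OF \<open>continuous_on {0..} K\<close>])
  define \<eta> where "\<eta> t = U t (projQ z (gen U z)) - integral {0..t} (\<lambda>s. K (t - s) *\<^sub>C U s z)" for t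
  have "gle_system U z K \<eta>"
    using K K_int by (simp add: gle \<eta>_def)
  moreover have "K' t = K t \<and> \<eta>' t = \<eta> t" if "gle_system U z K' \<eta>'" and "t \<ge> 0" for K' \<eta>' t
  proof -
    have "K' absolutely_integrable_on {0..s} \<and> volterra_eq U z K' s" if "s \<ge> 0" for s
      using \<open>gle_system U z K' \<eta>'\<close> that by (simp add: gle)
    then have "K' s = K s" if "s \<ge> 0" for s
      by (rule volterra_eq_unique[OF assms(1) _ _ that]) (simp_all add: K K_int)
    moreover from this have "integral {0..t} (\<lambda>s. K' (t - s) *\<^sub>C U s z)
        = integral {0..t} (\<lambda>s. K (t - s) *\<^sub>C U s z)"
      by (intro integral_cong) auto
    ultimately show ?thesis
      using that by (simp add: gle \<eta>_def)
  qed
  moreover have "K' t = K t" if "continuous_on {0..} K'" "\<forall>t\<ge>0. volterra_eq U z K' t" "t \<ge> 0" for K' t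
    using that K K_int
    by (intro volterra_eq_unique[OF assms(1) _ _ \<open>t \<ge> 0\<close>]) (auto simp: absolutely_integrable_on_Icc0)
  ultimately show ?thesis
    using \<open>continuous_on {0..} K\<close> K \<eta>_def by blast
qed

end
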